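(* Let $\pi:X\to Y$ be a one-block factor code from a one-step shift of finite type $X$ to a sofic shift $Y$. Let $f=\max\{|\pi_{\mathrm b}^{-1}(w)| : w\in\mathcal A(Y)\}$. Then there is a minimal transition block $(W,n,M)$ of $\pi$ with $$|W|\leq |\mathcal A(Y)|\times 2^{f^2+f+1}.$$
   Context: All shift spaces are one-dimensional (two-sided) over finite alphabets. $\mathcal A(X)$ and $\mathcal A(Y)$ denote the alphabets of $X$ and $Y$ (the sets of symbols occurring in their points). A block of a shift space is a finite word occurring in some point of it; $|W|$ is the length (number of symbols) of a block $W$, whose symbols are indexed from $0$. A shift of finite type $X$ is one-step if it consists of all bi-infinite sequences all of whose two-letter subwords belong to some fixed set of allowed two-letter words. A factor code is a continuous shift-commuting surjective map. It is one-block if it is induced by a symbol map $\pi_{\mathrm b}:\mathcal A(X)\to\mathcal A(Y)$, i.e. $\pi(x)_i=\pi_{\mathrm b}(x_i)$ for all $i$; $\pi_{\mathrm b}$ is extended symbolwise to blocks of $X$. For a block $W$ of $Y$, $\pi_{\mathrm b}^{-1}(W)$ is the set of blocks $U$ of $X$ with $\pi_{\mathrm b}(U)=W$, and for $0\le i<|W|$, $\pi_{\mathrm b}^{-1}(W)_i=\{a\in\mathcal A(X): \exists\, U\in\pi_{\mathrm b}^{-1}(W)\text{ with }U_i=a\}$. Transition blocks: let $W=W_0\dots W_p$ be a block of $Y$, let $0<n<p$, and let $M\subseteq\pi_{\mathrm b}^{-1}(W)_n$. A block $U\in\pi_{\mathrm b}^{-1}(W)$ is routable through $a\in M$ at time $n$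 if there is a block $U'\in\pi_{\mathrm b}^{-1}(W)$ with $U'_0=U_0$, $U'_n=a$ and $U'_p=U_p$. The triple $(W,n,M)$ is a transition block of $\pi$ if every block in $\pi_{\mathrm b}^{-1}(W)$ is routable through some symbol of $M$ at time $n$. The depth of $(W,n,M)$ is $|M|$. Let $c^*_\pi=\min\{|M| : (W,n,M)\text{ is a transition block of }\pi\}$. A minimal transition block of $\pi$ is a transition block of depth $c^*_\pi$. *)

theory Defs
  imports "HOL-Analysis.Function_Topology"
begin

type_synonym 'a biseq = "int \<Rightarrow> 'a"

definition full_shift_topology :: "'a biseq topology" where
  "full_shift_topology = product_topology (\<lambda>_. discrete_topology UNIV) UNIV"

definition shift :: "'a biseq \<Rightarrow> 'a biseq" where
  "shift x = (\<lambda>i. x (i + 1))"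

text \<open>The ambient type of symbols may be infinite; the first conjunct makes the set a subset of the
  full shift over a finite alphabet, which is itself closed in the topology above. The empty set is
  a shift space under this definition.\<close>

definition shift_space :: "'a biseq set \<Rightarrow> bool" where
  "shift_space X \<longleftrightarrow>
     (\<exists>A. finite A \<and> (\<forall>x\<in>X. \<forall>i. x i \<in> A)) \<and>
     closedin full_shift_topology X \<and> shift ` X = X"

definition alphabet :: "'a biseq set \<Rightarrow> 'a set" where
  "alphabet X = {x i |x i. x \<in> X}"

definition occurs_in :: "'a list \<Rightarrow> 'a biseq \<Rightarrow> bool" where
  "occurs_in W x \<longleftrightarrow> (\<exists>i. \<forall>k<length W. x (i + int k) = W ! k)"

definition blocks :: "'a biseq set \<Rightarrow> 'a list set" where
  "blocks X = {W. \<exists>x\<in>X. occurs_in W x}"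

definition sft :: "'a biseq set \<Rightarrow> bool" where
  "sft X \<longleftrightarrow> (\<exists>A F. finite A \<and> finite F \<and>
     X = {x. (\<forall>i. x i \<in> A) \<and> (\<forall>W\<in>F. \<not> occurs_in W x)})"

definition one_step_sft :: "'a biseq set \<Rightarrow> bool" where
  "one_step_sft X \<longleftrightarrow> sft X \<and> (\<exists>T. X = {x. \<forall>i. (x i, x (i + 1)) \<in> T})"

definition factor_code :: "'a biseq set \<Rightarrow> 'b biseq set \<Rightarrow> ('a biseq \<Rightarrow> 'b biseq) \<Rightarrow> bool" where
  "factor_code X Y \<phi> \<longleftrightarrow>
     continuous_map (subtopology full_shift_topology X) (subtopology full_shift_topology Y) \<phi> \<and>
     (\<forall>x\<in>X. \<phi> (shift x) = shift (\<phi> x)) \<and> \<phi> ` X = Y"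

text \<open>Taking the symbols of the covering shift of finite type in \<^typ>\<open>nat\<close> is no restriction, since
  every finite alphabet embeds in it.\<close>

definition sofic_shift :: "'b biseq set \<Rightarrow> bool" where
  "sofic_shift Y \<longleftrightarrow> shift_space Y \<and>
     (\<exists>(Z :: nat biseq set) \<phi>. sft Z \<and> factor_code Z Y \<phi>)"

definition one_block_factor_code ::
  "'a biseq set \<Rightarrow> 'b biseq set \<Rightarrow> ('a biseq \<Rightarrow> 'b biseq) \<Rightarrow> ('a \<Rightarrow> 'b) \<Rightarrow> bool" where
  "one_block_factor_code X Y \<pi> \<pi>\<^sub>b \<longleftrightarrow>
     factor_code X Y \<pi> \<and> (\<forall>x\<in>X. \<forall>i. \<pi> x i = \<pi>\<^sub>b (x i))"

text \<open>A symbol map is a total function on the type of symbols, of which only the values on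
  \<^term>\<open>alphabet X\<close> matter; hence all preimages below are taken inside \<^term>\<open>alphabet X\<close> or
  \<^term>\<open>blocks X\<close>.\<close>

definition symbol_preimage :: "'a biseq set \<Rightarrow> ('a \<Rightarrow> 'b) \<Rightarrow> 'b \<Rightarrow> 'a set" where
  "symbol_preimage X \<pi>\<^sub>b w = {a \<in> alphabet X. \<pi>\<^sub>b a = w}"

definition block_preimage :: "'a biseq set \<Rightarrow> ('a \<Rightarrow> 'b) \<Rightarrow> 'b list \<Rightarrow> 'a list set" where
  "block_preimage X \<pi>\<^sub>b W = {U \<in> blocks X. map \<pi>\<^sub>b U = W}"

definition block_preimage_at :: "'a biseq set \<Rightarrow> ('a \<Rightarrow> 'b) \<Rightarrow> 'b list \<Rightarrow> nat \<Rightarrow> 'a set" where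
  "block_preimage_at X \<pi>\<^sub>b W i = {a \<in> alphabet X. \<exists>U\<in>block_preimage X \<pi>\<^sub>b W. U ! i = a}"

text \<open>In the next two definitions, \<^term>\<open>length W - 1\<close> is the index \<open>p\<close> of the last symbol of
  \<open>W = W\<^sub>0 \<dots> W\<^sub>p\<close>.\<close>

definition routable ::
  "'a biseq set \<Rightarrow> ('a \<Rightarrow> 'b) \<Rightarrow> 'b list \<Rightarrow> 'a list \<Rightarrow> 'a \<Rightarrow> nat \<Rightarrow> bool" where
  "routable X \<pi>\<^sub>b W U a n \<longleftrightarrow>
     (\<exists>U'\<in>block_preimage X \<pi>\<^sub>b W.
        U' ! 0 = U ! 0 \<and> U' ! n = a \<and> U' ! (length W - 1) = U ! (length W - 1))"

definition transition_block ::
  "'a biseq set \<Rightarrow> 'b biseq set \<Rightarrow> ('a \<Rightarrow> 'b) \<Rightarrow> 'b list \<Rightarrow> nat \<Rightarrow> 'a set \<Rightarrow> bool" where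
  "transition_block X Y \<pi>\<^sub>b W n M \<longleftrightarrow>
     W \<in> blocks Y \<and> 0 < n \<and> n < length W - 1 \<and>
     M \<subseteq> block_preimage_at X \<pi>\<^sub>b W n \<and>
     (\<forall>U\<in>block_preimage X \<pi>\<^sub>b W. \<exists>a\<in>M. routable X \<pi>\<^sub>b W U a n)"

definition min_depth :: "'a biseq set \<Rightarrow> 'b biseq set \<Rightarrow> ('a \<Rightarrow> 'b) \<Rightarrow> nat" where
  "min_depth X Y \<pi>\<^sub>b = (LEAST d. \<exists>W n M. transition_block X Y \<pi>\<^sub>b W n M \<and> card M = d)"

definition minimal_transition_block ::
  "'a biseq set \<Rightarrow> 'b biseq set \<Rightarrow> ('a \<Rightarrow> 'b) \<Rightarrow> 'b list \<Rightarrow> nat \<Rightarrow> 'a set \<Rightarrow> bool" where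
  "minimal_transition_block X Y \<pi>\<^sub>b W n M \<longleftrightarrow>
     transition_block X Y \<pi>\<^sub>b W n M \<and> card M = min_depth X Y \<pi>\<^sub>b"

end

theory Submission
  imports Defs
begin

text \<open>For a block \<open>V\<close> of \<open>Y\<close>, let \<open>R V\<close> be the set of pairs (first symbol, last symbol) of the
  blocks of \<open>X\<close> above \<open>V\<close> (\<open>end_pairs\<close> below). Split a block \<open>W\<close> at an inner index \<open>n\<close> into two
  blocks \<open>V\<close> and \<open>V'\<close> that share the symbol \<open>W\<^sub>n\<close>. Because \<open>X\<close> is one-step, blocks of \<open>X\<close> that
  agree in one symbol can be glued there, so a block above \<open>W\<close> leads from \<open>a\<close> through \<open>m\<close> to \<open>b\<close>
  exactly if \<open>(a, m) \<in> R V\<close> and \<open>(m, b) \<in> R V'\<close> (\<open>block_through_iff\<close>). Hence whether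
  \<open>(W, n, M)\<close> is a transition block depends on the two relations \<open>R V\<close> and \<open>R V'\<close> only
  (\<open>transition_block_split_iff\<close>), and \<open>V\<close> and \<open>V'\<close> may be exchanged for any other blocks with the
  same relations, while \<open>M\<close>, and with it the depth, stays as it is.

  Such exchanges can be made short. Gluing also gives that \<open>R\<close> of a concatenation is the composition
  of relations (\<open>end_pairs_glue\<close>). So if two prefixes of \<open>V\<close> end in the same symbol and have the same
  \<open>R\<close>, the part of \<open>V\<close> between their ends can be cut out without changing \<open>R V\<close>. There are
  at most \<open>N = |\<A>(Y)| 2^(f^2)\<close> possibilities for the pair (last symbol, relation) of a prefix, as
  \<open>R\<close> relates two symbol fibres of size at most \<open>f\<close>; therefore \<open>V\<close> can be cut down
  to length at most \<open>N + 1\<close> (\<open>shorten_block\<close>). Doing this on both sides of a minimal transition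
  block yields one of length at most \<open>2 N + 1\<close>, which is within the bound because \<open>f \<ge> 1\<close>.\<close>

section \<open>Blocks of one-step shifts and gluing\<close>

lemma one_step_sft_translate:
  assumes "one_step_sft X" "x \<in> X"
  shows "(\<lambda>i. x (j + i)) \<in> X"
proof -
  obtain T where T: "X = {x. \<forall>i. (x i, x (i + 1)) \<in> T}"
    using assms(1) by (auto simp: one_step_sft_def)
  have "\<forall>i. (x (j + i), x (j + i + 1)) \<in> T" using assms(2) T by blast
  then show ?thesis unfolding T by (simp add: add.assoc)
qed

lemma blocks_iff_at_zero:
  assumes "one_step_sft X"
  shows "U \<in> blocks X \<longleftrightarrow> (\<exists>x\<in>X. \<forall>k<length U. x (int k) = U ! k)"
proof
  assume "U \<in> blocks X"
  then obtain x j where "x \<in> X" "\<forall>k<length U. x (j + int k) = U ! k"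
    by (auto simp: blocks_def occurs_in_def)
  then show "\<exists>x\<in>X. \<forall>k<length U. x (int k) = U ! k"
    using one_step_sft_translate[OF assms, of x j]
    by (intro bexI[of _ "\<lambda>i. x (j + i)"]) auto
next
  assume "\<exists>x\<in>X. \<forall>k<length U. x (int k) = U ! k"
  then show "U \<in> blocks X"
    unfolding blocks_def occurs_in_def by (auto intro!: bexI exI[of _ "0::int"])
qed

lemma blocks_appendD:
  assumes "U @ V \<in> blocks X"
  shows "U \<in> blocks X" "V \<in> blocks X"
proof -
  obtain x j where x: "x \<in> X" "\<forall>k<length (U @ V). x (j + int k) = (U @ V) ! k"
    using assms by (auto simp: blocks_def occurs_in_def)
  have "\<forall>k<length U. x (j + int k) = U ! k"
    using x(2) by (simp add: nth_append)
  with x(1) show "U \<in> blocks X" by (auto simp: blocks_def occurs_in_def)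
  have "x ((j + int (length U)) + int k) = V ! k" if "k < length V" for k
    using x(2)[rule_format, of "length U + k"] that by (simp add: nth_append add.assoc)
  with x(1) show "V \<in> blocks X" by (auto simp: blocks_def occurs_in_def)
qed

text \<open>The follower condition of a one-step shift looks at two adjacent symbols only, so the left
  half of one point and the right half of another may be joined where they agree in a symbol.\<close>

lemma blocks_glue:
  assumes X: "one_step_sft X" and U: "C @ [m] \<in> blocks X" and V: "m # D \<in> blocks X"
  shows "C @ m # D \<in> blocks X"
proof -
  obtain T where T: "X = {x. \<forall>i. (x i, x (i + 1)) \<in> T}"
    using X by (auto simp: one_step_sft_def)
  obtain x where x: "x \<in> X" "\<forall>k<length (C @ [m]). x (int k) = (C @ [m]) ! k"
    using U blocks_iff_at_zero[OF X] by blast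
  obtain y where y: "y \<in> X" "\<forall>k<length (m # D). y (int k) = (m # D) ! k"
    using V blocks_iff_at_zero[OF X] by blast
  define l where "l = int (length C)"
  define z where "z i = (if i \<le> l then x i else y (i - l))" for i
  have xl: "x l = m" using x(2)[rule_format, of "length C"] by (simp add: l_def)
  have y0: "y 0 = m" using y(2)[rule_format, of 0] by simp
  have "(z i, z (i + 1)) \<in> T" for i
  proof -
    have xi: "(x i, x (i + 1)) \<in> T" and yi: "(y (i - l), y (i - l + 1)) \<in> T"
      using x(1) y(1) T by auto
    have eq: "i + 1 - l = i - l + 1" by simp
    consider "i < l" | "i = l" | "i > l" by linarith
    then show ?thesis
      using xi yi xl y0 by cases (auto simp: z_def eq)
  qed
  then have "z \<in> X" unfolding T by blast
  moreover have "z (int k) = (C @ m # D) ! k" if "k < length (C @ m # D)" for k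
  proof (cases "k \<le> length C")
    case True
    then show ?thesis
      using x(2)[rule_format, of k] by (auto simp: z_def l_def nth_append)
  next
    case False
    then have "int k - l = int (k - length C)" by (simp add: l_def)
    then show ?thesis
      using False that y(2)[rule_format, of "k - length C"] by (simp add: z_def l_def nth_append)
  qed
  ultimately show ?thesis unfolding blocks_iff_at_zero[OF X] by blast
qed

section \<open>The relation between the end symbols of the blocks above a block\<close>

definition end_pairs :: "'a biseq set \<Rightarrow> ('a \<Rightarrow> 'b) \<Rightarrow> 'b list \<Rightarrow> ('a \<times> 'a) set" where
  "end_pairs X \<pi>\<^sub>b V = {(U ! 0, U ! (length V - 1)) | U. U \<in> block_preimage X \<pi>\<^sub>b V}"

lemma end_pairsI:
  assumes "U \<in> block_preimage X \<pi>\<^sub>b V" "U ! 0 = a" "U ! (length V - 1) = b"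
  shows "(a, b) \<in> end_pairs X \<pi>\<^sub>b V"
  using assms by (auto simp: end_pairs_def)

lemma blocks_set_subset: "U \<in> blocks X \<Longrightarrow> set U \<subseteq> alphabet X"
  by (auto simp: blocks_def occurs_in_def alphabet_def in_set_conv_nth) metis

lemma end_pairs_subset:
  assumes "V \<noteq> []"
  shows "end_pairs X \<pi>\<^sub>b V \<subseteq> symbol_preimage X \<pi>\<^sub>b (hd V) \<times> symbol_preimage X \<pi>\<^sub>b (last V)"
proof -
  have "U ! 0 \<in> symbol_preimage X \<pi>\<^sub>b (hd V)
      \<and> U ! (length V - 1) \<in> symbol_preimage X \<pi>\<^sub>b (last V)"
    if "U \<in> block_preimage X \<pi>\<^sub>b V" for U
  proof -
    have U: "U \<in> blocks X" "map \<pi>\<^sub>b U = V" using that by (auto simp: block_preimage_def)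
    then have "U \<noteq> []" using assms by auto
    moreover have "length V = length U" using U(2) by auto
    ultimately have h: "U ! 0 = hd U" "U ! (length V - 1) = last U"
      by (simp_all add: hd_conv_nth last_conv_nth)
    have "hd U \<in> alphabet X" "last U \<in> alphabet X"
      using blocks_set_subset[OF U(1)] \<open>U \<noteq> []\<close> by auto
    moreover have "\<pi>\<^sub>b (hd U) = hd V" "\<pi>\<^sub>b (last U) = last V"
      using U(2) \<open>U \<noteq> []\<close> by (auto simp: hd_map last_map)
    ultimately show ?thesis unfolding h symbol_preimage_def by simp
  qed
  then show ?thesis unfolding end_pairs_def by blast
qed

lemma block_through_iff:
  assumes X: "one_step_sft X"
  shows "(\<exists>U\<in>block_preimage X \<pi>\<^sub>b (A @ w # B).
            U ! 0 = a \<and> U ! length A = m \<and> U ! (length (A @ w # B) - 1) = b)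
         \<longleftrightarrow> (a, m) \<in> end_pairs X \<pi>\<^sub>b (A @ [w]) \<and> (m, b) \<in> end_pairs X \<pi>\<^sub>b (w # B)"
    (is "?L \<longleftrightarrow> ?R")
proof
  assume ?L
  then obtain U where U: "U \<in> blocks X" "map \<pi>\<^sub>b U = A @ w # B"
    and e: "U ! 0 = a" "U ! length A = m" "U ! (length (A @ w # B) - 1) = b"
    unfolding block_preimage_def by blast
  define C c D where "C = take (length A) U" and "c = U ! length A" and "D = drop (Suc (length A)) U"
  have lU: "length A < length U" using arg_cong[OF U(2), of length] by simp
  have CD: "U = C @ c # D" "map \<pi>\<^sub>b C = A" "\<pi>\<^sub>b c = w" "map \<pi>\<^sub>b D = B"
    using lU id_take_nth_drop[OF lU] U(2) nth_map[OF lU, of \<pi>\<^sub>b]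
    by (simp_all add: C_def c_def D_def take_map[symmetric] drop_map[symmetric])
  have l: "length A = length C" "length B = length D" using CD(2,4) by auto
  have "C @ [c] \<in> blocks X" "c # D \<in> blocks X"
    using U(1) blocks_appendD[of "C @ [c]" D X] blocks_appendD[of C "c # D" X] CD(1) by auto
  then have "C @ [c] \<in> block_preimage X \<pi>\<^sub>b (A @ [w])" "c # D \<in> block_preimage X \<pi>\<^sub>b (w # B)"
    using CD(2-4) by (simp_all add: block_preimage_def)
  moreover have "(C @ [c]) ! 0 = a" "c = m" "(c # D) ! length B = b"
    using e l unfolding CD(1) by (simp_all add: nth_append split: if_splits)
  ultimately show ?R
    using l end_pairsI[of "C @ [c]" X \<pi>\<^sub>b "A @ [w]" a m] end_pairsI[of "c # D" X \<pi>\<^sub>b "w # B" m b]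
    by simp
next
  assume ?R
  then obtain U V where U: "U \<in> blocks X" "map \<pi>\<^sub>b U = A @ [w]"
    and V: "V \<in> blocks X" "map \<pi>\<^sub>b V = w # B"
    and e: "a = U ! 0" "m = U ! length A" "m = V ! 0" "b = V ! length B"
    unfolding end_pairs_def block_preimage_def by auto
  obtain C c where C: "U = C @ [c]" "map \<pi>\<^sub>b C = A" "\<pi>\<^sub>b c = w"
    using U(2) by (cases U rule: rev_cases) simp_all
  obtain d D where D: "V = d # D" "map \<pi>\<^sub>b D = B"
    using V(2) by (cases V) simp_all
  have l: "length A = length C" "length B = length D" using C(2) D(2) by auto
  have cd: "c = m" "d = m" using e C(1) D(1) l by auto
  have "C @ m # D \<in> blocks X"
    using blocks_glue[OF X, of C m D] U(1) V(1) C(1) D(1) cd by simp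
  then have "C @ m # D \<in> block_preimage X \<pi>\<^sub>b (A @ w # B)"
    using C(2,3) D(2) cd by (simp add: block_preimage_def)
  moreover have "(C @ m # D) ! 0 = a" "(C @ m # D) ! length A = m"
    "(C @ m # D) ! (length (A @ w # B) - 1) = b"
    using e(1,4) cd l unfolding C(1) D(1) by (simp_all add: nth_append)
  ultimately show ?L by blast
qed

lemma end_pairs_glue:
  assumes X: "one_step_sft X"
  shows "end_pairs X \<pi>\<^sub>b (A @ w # B) = end_pairs X \<pi>\<^sub>b (A @ [w]) O end_pairs X \<pi>\<^sub>b (w # B)"
proof -
  have "(a, b) \<in> end_pairs X \<pi>\<^sub>b (A @ w # B)
      \<longleftrightarrow> (\<exists>m. \<exists>U\<in>block_preimage X \<pi>\<^sub>b (A @ w # B).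
            U ! 0 = a \<and> U ! length A = m \<and> U ! (length (A @ w # B) - 1) = b)" for a b
    unfolding end_pairs_def by blast
  then show ?thesis unfolding block_through_iff[OF X] by auto
qed

section \<open>Transition blocks in terms of end pairs\<close>

lemma one_block_image:
  assumes "one_block_factor_code X Y \<pi> \<pi>\<^sub>b"
  shows "W \<in> blocks Y \<longleftrightarrow> block_preimage X \<pi>\<^sub>b W \<noteq> {}"
    and "alphabet Y = \<pi>\<^sub>b ` alphabet X"
proof -
  have Y: "Y = \<pi> ` X" and p: "\<And>x i. x \<in> X \<Longrightarrow> \<pi> x i = \<pi>\<^sub>b (x i)"
    using assms by (auto simp: one_block_factor_code_def factor_code_def)
  show "alphabet Y = \<pi>\<^sub>b ` alphabet X"
    unfolding alphabet_def Y using p by (auto simp: image_iff) metis+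
  show "W \<in> blocks Y \<longleftrightarrow> block_preimage X \<pi>\<^sub>b W \<noteq> {}"
  proof
    assume "W \<in> blocks Y"
    then obtain x j where x: "x \<in> X" "\<forall>k<length W. \<pi> x (j + int k) = W ! k"
      by (auto simp: blocks_def occurs_in_def Y)
    let ?U = "map (\<lambda>k. x (j + int k)) [0..<length W]"
    have "?U \<in> blocks X" using x(1) by (auto simp: blocks_def occurs_in_def)
    moreover have "map \<pi>\<^sub>b ?U = W" using x p by (auto intro!: nth_equalityI)
    ultimately show "block_preimage X \<pi>\<^sub>b W \<noteq> {}" by (auto simp: block_preimage_def)
  next
    assume "block_preimage X \<pi>\<^sub>b W \<noteq> {}"
    then obtain U x j where "map \<pi>\<^sub>b U = W" "x \<in> X" "\<forall>k<length U. x (j + int k) = U ! k"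
      by (auto simp: block_preimage_def blocks_def occurs_in_def)
    then have "\<pi> x \<in> Y" "\<forall>k<length W. \<pi> x (j + int k) = W ! k" using p Y by auto
    then show "W \<in> blocks Y" by (auto simp: blocks_def occurs_in_def)
  qed
qed

text \<open>Every condition on a transition block speaks of the first symbol, the symbol at time \<open>n\<close> and the
  last symbol of a block above \<open>W\<close> only, and by gluing the possible triples are those that the two
  relations allow.\<close>

lemma transition_block_split_iff:
  fixes A B :: "'b list" and w :: 'b
  assumes X: "one_step_sft X" and code: "one_block_factor_code X Y \<pi> \<pi>\<^sub>b"
  defines "R \<equiv> end_pairs X \<pi>\<^sub>b (A @ [w])" and "S \<equiv> end_pairs X \<pi>\<^sub>b (w # B)"
  shows "transition_block X Y \<pi>\<^sub>b (A @ w # B) (length A) M \<longleftrightarrow>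
     A \<noteq> [] \<and> B \<noteq> [] \<and> R O S \<noteq> {} \<and> M \<subseteq> Range R \<inter> Domain S \<and>
     (\<forall>(a, b) \<in> R O S. \<exists>m\<in>M. (a, m) \<in> R \<and> (m, b) \<in> S)"
proof -
  let ?W = "A @ w # B"
  let ?P = "block_preimage X \<pi>\<^sub>b ?W"
  note through = block_through_iff[OF X, of \<pi>\<^sub>b A w B, folded R_def S_def]
  have RS: "R O S = {(U ! 0, U ! (length ?W - 1)) | U. U \<in> ?P}"
    using end_pairs_glue[OF X, of \<pi>\<^sub>b A w B] by (simp add: R_def S_def end_pairs_def)
  have "block_preimage_at X \<pi>\<^sub>b ?W (length A) = {m. \<exists>U\<in>?P. U ! length A = m}"
  proof -
    have "U ! length A \<in> alphabet X" if "U \<in> ?P" for U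
    proof -
      have "U \<in> blocks X" "length U = length ?W"
        using that by (auto simp: block_preimage_def dest: arg_cong[where f = length])
      then show ?thesis using blocks_set_subset nth_mem[of "length A" U] by fastforce
    qed
    then show ?thesis unfolding block_preimage_at_def by blast
  qed
  also have "\<dots> = {m. \<exists>a b. \<exists>U\<in>?P. U ! 0 = a \<and> U ! length A = m \<and> U ! (length ?W - 1) = b}"
    by blast
  also have "\<dots> = Range R \<inter> Domain S" unfolding through by blast
  finally have at: "block_preimage_at X \<pi>\<^sub>b ?W (length A) = Range R \<inter> Domain S" .
  have rout: "routable X \<pi>\<^sub>b ?W U m (length A)
      \<longleftrightarrow> (U ! 0, m) \<in> R \<and> (m, U ! (length ?W - 1)) \<in> S" for U m
    unfolding routable_def through ..
  have all: "(\<forall>U\<in>?P. \<exists>m\<in>M. routable X \<pi>\<^sub>b ?W U m (length A))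
      \<longleftrightarrow> (\<forall>(a, b) \<in> R O S. \<exists>m\<in>M. (a, m) \<in> R \<and> (m, b) \<in> S)"
    unfolding rout RS by blast
  have "?W \<in> blocks Y \<longleftrightarrow> R O S \<noteq> {}"
    unfolding one_block_image(1)[OF code] RS by blast
  then show ?thesis
    unfolding transition_block_def at all by auto
qed

lemma end_pairs_nonemptyD:
  assumes "one_block_factor_code X Y \<pi> \<pi>\<^sub>b" "end_pairs X \<pi>\<^sub>b V \<noteq> {}"
  shows "set V \<subseteq> alphabet Y"
proof -
  obtain U where "U \<in> blocks X" "map \<pi>\<^sub>b U = V"
    using assms(2) by (auto simp: end_pairs_def block_preimage_def)
  then show ?thesis
    using blocks_set_subset one_block_image(2)[OF assms(1)] by fastforce
qed

section \<open>Shortening\<close>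

text \<open>Prefixes of length 1 are left out of the pigeonhole argument, so that the shortened block still
  has length at least 2; this keeps the transition time in the interior when the block is used as
  one side of a transition block.\<close>

lemma shorten_block:
  assumes X: "one_step_sft X" and code: "one_block_factor_code X Y \<pi> \<pi>\<^sub>b"
    and finX: "finite (alphabet X)"
    and f: "\<And>w. w \<in> alphabet Y \<Longrightarrow> card (symbol_preimage X \<pi>\<^sub>b w) \<le> f"
    and "end_pairs X \<pi>\<^sub>b V \<noteq> {}" and "2 \<le> length V"
  shows "\<exists>V'. end_pairs X \<pi>\<^sub>b V' = end_pairs X \<pi>\<^sub>b V \<and> hd V' = hd V \<and> last V' = last V \<and>
           2 \<le> length V' \<and> length V' \<le> card (alphabet Y) * 2 ^ f\<^sup>2 + 1"
  using assms(5,6)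
proof (induction V rule: length_induct)
  case (1 V)
  let ?R = "end_pairs X \<pi>\<^sub>b" and ?F = "symbol_preimage X \<pi>\<^sub>b"
  let ?N = "card (alphabet Y) * 2 ^ f\<^sup>2"
  show ?case
  proof (cases "length V \<le> ?N + 1")
    case True
    then show ?thesis using 1(3) by blast
  next
    case False
    define g where "g k = (V ! k, ?R (take (Suc k) V))" for k
    define Q where "Q = Sigma (alphabet Y) (\<lambda>w. Pow (?F (hd V) \<times> ?F w))"
    have VY: "set V \<subseteq> alphabet Y" using end_pairs_nonemptyD[OF code 1(2)] .
    have ne: "V \<noteq> []" using 1(3) by auto
    have finF: "finite (?F w)" for w using finX by (simp add: symbol_preimage_def)
    have finY: "finite (alphabet Y)" using finX one_block_image(2)[OF code] by simp
    have gQ: "g ` {1..<length V} \<subseteq> Q"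
    proof
      fix q assume "q \<in> g ` {1..<length V}"
      then obtain k where k: "q = g k" "k < length V" by auto
      have "take (Suc k) V = take k V @ [V ! k]" using k(2) by (rule take_Suc_conv_app_nth)
      then have "last (take (Suc k) V) = V ! k" by simp
      moreover have "hd (take (Suc k) V) = hd V" by simp
      ultimately have "?R (take (Suc k) V) \<subseteq> ?F (hd V) \<times> ?F (V ! k)"
        using end_pairs_subset[of "take (Suc k) V" X \<pi>\<^sub>b] ne by simp
      moreover have "V ! k \<in> alphabet Y" using k(2) VY by auto
      ultimately show "q \<in> Q" unfolding k(1) g_def Q_def by blast
    qed
    have finQ: "finite Q" unfolding Q_def using finY finF by auto
    have "card Q = (\<Sum>w\<in>alphabet Y. card (Pow (?F (hd V) \<times> ?F w)))"
      unfolding Q_def using finY finF by (intro card_SigmaI) auto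
    also have "\<dots> \<le> (\<Sum>w\<in>alphabet Y. 2 ^ f\<^sup>2)"
    proof (rule sum_mono)
      fix w assume "w \<in> alphabet Y"
      moreover have "hd V \<in> alphabet Y" using VY ne by auto
      ultimately have "card (?F (hd V)) * card (?F w) \<le> f * f" by (intro mult_mono f) auto
      then show "card (Pow (?F (hd V) \<times> ?F w)) \<le> 2 ^ f\<^sup>2"
        using finF by (simp add: card_Pow card_cartesian_product power2_eq_square)
    qed
    finally have "card Q \<le> ?N" by simp
    moreover have "card {1..<length V} > ?N" using False by simp
    ultimately have "\<not> inj_on g {1..<length V}"
      using card_inj_on_le[OF _ gQ finQ] by fastforce
    then obtain i j where ij: "1 \<le> i" "i < j" "j < length V" "g i = g j"
      unfolding inj_on_def by (metis atLeastLessThan_iff linorder_neqE_nat)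
    define w B where "w = V ! j" and "B = drop (Suc j) V"
    have ti: "take (Suc i) V = take i V @ [w]"
      using ij by (simp add: g_def w_def take_Suc_conv_app_nth)
    have tj: "take (Suc j) V = take j V @ [w]"
      using ij by (simp add: w_def take_Suc_conv_app_nth)
    have V: "V = take j V @ w # B"
      using ij(3) by (simp add: w_def B_def id_take_nth_drop[symmetric])
    define V' where "V' = take i V @ w # B"
    have "?R V' = ?R (take (Suc i) V) O ?R (w # B)"
      unfolding V'_def end_pairs_glue[OF X, of \<pi>\<^sub>b "take i V" w B] ti ..
    also have "\<dots> = ?R (take (Suc j) V) O ?R (w # B)" using ij(4) by (simp add: g_def)
    also have "\<dots> = ?R V"
      using end_pairs_glue[OF X, of \<pi>\<^sub>b "take j V" w B] V tj by simp
    finally have RV: "?R V' = ?R V" .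
    have "length V' < length V" using ij unfolding V'_def B_def by simp
    moreover have "2 \<le> length V'" using ij unfolding V'_def by simp
    moreover have "hd V' = hd V" using ij ne unfolding V'_def by (simp add: hd_append)
    moreover have "last V' = last V"
      unfolding V'_def by (subst V) simp
    ultimately show ?thesis using 1(1)[rule_format, of V'] RV 1(2) by auto
  qed
qed

section \<open>The length bound\<close>

lemma minimal_transition_block_exists:
  assumes "X \<noteq> {}" and code: "one_block_factor_code X Y \<pi> \<pi>\<^sub>b"
  shows "\<exists>W n M. minimal_transition_block X Y \<pi>\<^sub>b W n M"
proof -
  obtain x where x: "x \<in> X" using assms(1) by auto
  \<comment> \<open>Every block is routable through its own symbol, so the full preimage works at any inner time.\<close>
  define U where "U = map (\<lambda>k. x (int k)) [0..<3]"
  define W where "W = map \<pi>\<^sub>b U"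
  have "U \<in> blocks X"
    unfolding blocks_def occurs_in_def U_def using x by (auto intro!: bexI exI[of _ "0::int"])
  then have "U \<in> block_preimage X \<pi>\<^sub>b W" by (simp add: block_preimage_def W_def)
  then have W: "W \<in> blocks Y" using one_block_image(1)[OF code] by blast
  have l: "length W = 3" by (simp add: W_def U_def)
  have "V ! 1 \<in> block_preimage_at X \<pi>\<^sub>b W 1" if V: "V \<in> block_preimage X \<pi>\<^sub>b W" for V
  proof -
    have "V \<in> blocks X" "length V = length W" using V by (auto simp: block_preimage_def)
    then have "V ! 1 \<in> alphabet X" using blocks_set_subset[of V X] nth_mem[of 1 V] l by auto
    then show ?thesis using V by (auto simp: block_preimage_at_def)
  qed
  then have "transition_block X Y \<pi>\<^sub>b W 1 (block_preimage_at X \<pi>\<^sub>b W 1)"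
    unfolding transition_block_def routable_def using W l by auto
  then have "\<exists>d W n M. transition_block X Y \<pi>\<^sub>b W n M \<and> card M = d" by blast
  from LeastI_ex[OF this] show ?thesis
    unfolding minimal_transition_block_def min_depth_def by blast
qed

theorem theorem4p1:
  fixes X :: "'a biseq set" and Y :: "'b biseq set"
    and \<pi> :: "'a biseq \<Rightarrow> 'b biseq" and \<pi>\<^sub>b :: "'a \<Rightarrow> 'b" and f :: nat
  assumes "one_step_sft X" and "X \<noteq> {}"
    and "sofic_shift Y"
    and "one_block_factor_code X Y \<pi> \<pi>\<^sub>b"
    and "f = Max ((\<lambda>w. card (symbol_preimage X \<pi>\<^sub>b w)) ` alphabet Y)"
  shows "\<exists>W n M. minimal_transition_block X Y \<pi>\<^sub>b W n M \<and>
           length W \<le> card (alphabet Y) * 2 ^ (f\<^sup>2 + f + 1)"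
proof -
  let ?R = "end_pairs X \<pi>\<^sub>b" and ?N = "card (alphabet Y) * 2 ^ f\<^sup>2"
  note X = assms(1) and code = assms(4)
  have finX: "finite (alphabet X)"
  proof -
    obtain A where "finite A" "\<forall>x\<in>X. \<forall>i. x i \<in> A"
      using X by (auto simp: one_step_sft_def sft_def)
    then show ?thesis by (auto simp: alphabet_def intro: finite_subset[of _ A])
  qed
  have finY: "finite (alphabet Y)" using finX one_block_image(2)[OF code] by simp
  have f: "card (symbol_preimage X \<pi>\<^sub>b w) \<le> f" if "w \<in> alphabet Y" for w
    unfolding assms(5) using finY that by (intro Max_ge) auto
  obtain W n M where min: "minimal_transition_block X Y \<pi>\<^sub>b W n M"
    using minimal_transition_block_exists[OF assms(2) code] by blast
  then have tr: "transition_block X Y \<pi>\<^sub>b W n M" and card: "card M = min_depth X Y \<pi>\<^sub>b"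
    by (auto simp: minimal_transition_block_def)
  have n: "n < length W" using tr by (auto simp: transition_block_def)
  define A w B where "A = take n W" and "w = W ! n" and "B = drop (Suc n) W"
  have W: "W = A @ w # B" "length A = n"
    using n by (auto simp: A_def w_def B_def id_take_nth_drop[symmetric])
  have tr': "transition_block X Y \<pi>\<^sub>b (A @ w # B) (length A) M" using tr W by simp
  note split = tr'[unfolded transition_block_split_iff[OF X code]]
  have ne: "?R (A @ [w]) \<noteq> {}" "?R (w # B) \<noteq> {}" and AB: "A \<noteq> []" "B \<noteq> []"
    using split by auto
  obtain V where V: "?R V = ?R (A @ [w])" "last V = w" "2 \<le> length V" "length V \<le> ?N + 1"
    using shorten_block[OF X code finX f ne(1)] AB by (auto simp: Suc_le_eq)
  obtain V' where V': "?R V' = ?R (w # B)" "hd V' = w" "2 \<le> length V'" "length V' \<le> ?N + 1"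
    using shorten_block[OF X code finX f ne(2)] AB by (auto simp: Suc_le_eq)
  define A' B' where "A' = butlast V" and "B' = tl V'"
  have VA: "V = A' @ [w]" using V(2,3) unfolding A'_def by (cases V rule: rev_cases) auto
  have VB: "V' = w # B'" using V'(2,3) unfolding B'_def by (cases V') auto
  have AB': "A' \<noteq> []" "B' \<noteq> []" using V(3) V'(3) VA VB by auto
  have "transition_block X Y \<pi>\<^sub>b (A' @ w # B') (length A') M"
    unfolding transition_block_split_iff[OF X code]
    using split AB' V(1) V'(1) unfolding VA VB by simp
  then have "minimal_transition_block X Y \<pi>\<^sub>b (A' @ w # B') (length A') M"
    using card by (simp add: minimal_transition_block_def)
  moreover have "length (A' @ w # B') \<le> card (alphabet Y) * 2 ^ (f\<^sup>2 + f + 1)"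
  proof -
    \<comment> \<open>The two sides share \<open>w\<close>, so the glued block has length at most \<open>2 N + 1 \<le> 4 N\<close>; the fibre of \<open>w\<close> is
      not empty, so \<open>f \<ge> 1\<close> and the factor \<open>2^(f + 1)\<close> of the bound covers the 4.\<close>
    have wY: "w \<in> alphabet Y" using end_pairs_nonemptyD[OF code ne(2)] by simp
    then have "symbol_preimage X \<pi>\<^sub>b w \<noteq> {}"
      using one_block_image(2)[OF code] by (auto simp: symbol_preimage_def)
    moreover have "finite (symbol_preimage X \<pi>\<^sub>b w)" using finX by (simp add: symbol_preimage_def)
    ultimately have "1 \<le> f" using f[OF wY] by (metis One_nat_def Suc_leI card_gt_0_iff le_trans)
    then have "(2::nat) ^ 1 \<le> 2 ^ f" by (intro power_increasing) auto
    then have "?N * 4 \<le> ?N * (2 * 2 ^ f)" by (intro mult_le_mono) auto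
    also have "\<dots> = card (alphabet Y) * 2 ^ (f\<^sup>2 + f + 1)" by (simp add: power_add)
    finally have "?N * 4 \<le> card (alphabet Y) * 2 ^ (f\<^sup>2 + f + 1)" .
    moreover have "1 \<le> ?N" using V(3,4) by linarith
    moreover have "length (A' @ w # B') \<le> ?N + ?N + 1"
      using V(4) V'(4) VA VB by simp
    ultimately show ?thesis by linarith
  qed
  ultimately show ?thesis by blast
qed

end
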